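(* Let $\Theta=(\Gamma,(x_{k,i}))$ be a patch framework with $\Gamma$ connected and with every view affinely non-degenerate. Let $S$ be a perfect alignment. The realization $\Theta(S)$ is infinitesimally rigid if and only if the alignment $S$ is non-degenerate.
   Context: Patch framework. $\Gamma$ is a bipartite graph on $n+m$ vertices; vertex $k\in\{1,\dots,n\}$ represents the $k$th point and vertex $n+i$, $i\in\{1,\dots,m\}$, the $i$th view; $(k,i)\in E(\Gamma)$ means that point $k$ is in view $i$, with local coordinates $x_{k,i}\in\mathbb{R}^d$. The tuple $\Theta=(\Gamma,(x_{k,i}))$ is a patch framework. A view $i$ is affinely non-degenerate if it has at least $d+1$ points and the affine span of $\{x_{k,i}:(k,i)\in E(\Gamma)\}$ has dimension $d$. Put $e_{ki}=e_k-e_{n+i}\in\mathbb{R}^{n+m}$, $\varepsilon_i$ the $i$th standard basis vector of $\mathbb{R}^m$, $\mathcal{L}_\Gamma=\sum_{(k,i)\in E(\Gamma)}e_{ki}e_{ki}^T$, $B=\sum_{(k,i)\in E(\Gamma)}(\varepsilon_i\otimes I_d)x_{k,i}e_{ki}^T$, $D=\sum_{(k,i)\in E(\Gamma)}(\varepsilon_i\otimes I_d)x_{k,i}x_{k,i}^T(\varepsilon_i\otimes I_d)^T$, and $C=D-B\mathcal{L}_\Gamma^\dagger B^T\in\mathbb{R}^{md\times md}$ (positive semi-definite), where $\dagger$ is the Moore–Penrose pseudoinverse. An alignment is an element $S=[S_i]_1^m$ (vertical stack) of $\mathbb{O}(d)^m\subseteq\mathbb{R}^{md\times d}$; $F(S)=\mathrm{Tr}(CSS^T)$;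 $S$ is perfect if $F(S)=0$. Non-degeneracy. Let $\pi:\mathbb{O}(d)^m\to\mathbb{O}(d)^{m-1}$, $\pi(S)=[S_{i+1}S_1^T]_{i=1}^{m-1}$ (this identifies $\mathbb{O}(d)^m/_\sim$, $S\sim SQ$ for $Q\in\mathbb{O}(d)$, with $\mathbb{O}(d)^{m-1}$), and $\widetilde F:\mathbb{O}(d)^{m-1}\to\mathbb{R}$, $\widetilde F(\widetilde S)=\mathrm{Tr}\left(C\begin{bmatrix}I_d\\ \widetilde S\end{bmatrix}\begin{bmatrix}I_d\\ \widetilde S\end{bmatrix}^T\right)$, so $F=\widetilde F\circ\pi$. $S$ is non-degenerate if $\pi(S)$ is a non-degenerate local minimum of $\widetilde F$, i.e. a local minimizer at which the Hessian of $\widetilde F$ is non-singular (at a critical point this does not depend on the Riemannian metric). Realization. For an alignment $S$, $\Theta(S)=S^TB\,\mathcal{L}_\Gamma^\dagger(:,1{:}n)\,(I_n-n^{-1}\mathbf{1}_n\mathbf{1}_n^T)\in\mathbb{R}^{d\times n}$, where $(:,1{:}n)$ denotes the first $n$ columns and $\mathbf{1}_n$ the all-ones vector; its columns are denoted $x_1(S),\dots,x_n(S)$. When $S$ is perfect, $\Theta(S)$ is called a realization. $\Theta(S)$ is infinitesimally rigid if there does not exist $(p_k)_1^n\subseteq\mathbb{R}^d$ such that (i) $(p_k)$ is not trivial, where trivial means that there exist a skew-symmetric $\Omega\in\mathbb{R}^{d\times d}$ and $t\in\mathbb{R}^d$ with $p_k=\Omega x_k(S)+t$ for all $k$; and (ii)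 $(x_{k_1}(S)-x_{k_2}(S))^T(p_{k_1}-p_{k_2})=0$ for all $i$ and all $(k_1,i),(k_2,i)\in E(\Gamma)$. *)

theory Defs
  imports "HOL-Analysis.Analysis"
begin

text \<open>
  Conventions.  The index types \<open>'n\<close>, \<open>'m\<close>, \<open>'d\<close> stand for \<open>{1..n}\<close> (points), \<open>{1..m}\<close> (views)
  and \<open>{1..d}\<close> (coordinates).  The vertex set of \<open>\<Gamma>\<close> is the sum type \<open>'n + 'm\<close>, the graph itself is
  given by its incidences \<open>E\<close>: \<open>(k, i) \<in> E\<close> iff point \<open>k\<close> is in view \<open>i\<close>.  The coordinates
  \<open>x k i\<close> are only ever used for \<open>(k, i) \<in> E\<close>.  Row index \<open>(i, c) :: 'm \<times> 'd\<close> of an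
  \<open>md\<close>-dimensional vector is entry \<open>c\<close> of block \<open>i\<close>.  A block tuple \<open>[S\<^sub>i]\<close> of \<open>d \<times> d\<close> matrices has
  type \<open>real^'d^'d^'m\<close>, with blocks \<open>S $ i\<close>; its inner product is the Frobenius one.  The view
  labelled 1 in the quotient by \<open>O(d)\<close> is an arbitrary but fixed \<open>v1 :: 'm\<close>.
\<close>

section \<open>Matrices\<close>

definition outer :: "real^'a \<Rightarrow> real^'b \<Rightarrow> real^'b^'a" where
  "outer u v = (\<chi> i j. u $ i * v $ j)"

text \<open>Kronecker product of a column vector with a matrix.\<close>

definition kron_vec :: "real^'m \<Rightarrow> real^'b^'a \<Rightarrow> real^'b^('m::finite \<times> 'a::finite)" where
  "kron_vec u A = (\<chi> p c. u $ fst p * A $ snd p $ c)"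

definition is_pinv :: "real^'b^'a \<Rightarrow> real^'a^'b \<Rightarrow> bool" where
  "is_pinv A X \<longleftrightarrow> A ** X ** A = A \<and> X ** A ** X = X \<and>
     transpose (A ** X) = A ** X \<and> transpose (X ** A) = X ** A"

definition pinv :: "real^'b^'a \<Rightarrow> real^'a^'b" where
  "pinv A = (THE X. is_pinv A X)"

lemma is_pinv_unique:
  assumes "is_pinv A X" "is_pinv A Y"
  shows "X = Y"
proof -
  have "X = X ** (A ** X)"
    using assms(1) by (simp add: is_pinv_def matrix_mul_assoc)
  also have "A ** X = transpose (A ** Y ** A ** X)"
    using assms by (simp add: is_pinv_def)
  also have "\<dots> = transpose (A ** X) ** transpose (A ** Y)"
    by (simp add: matrix_transpose_mul[symmetric] matrix_mul_assoc)
  also have "\<dots> = A ** X ** (A ** Y)"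
    using assms by (simp add: is_pinv_def)
  also have "\<dots> = A ** Y"
    using assms(1) by (simp add: is_pinv_def matrix_mul_assoc)
  finally have 1: "X = X ** A ** Y"
    by (simp add: matrix_mul_assoc)
  have "Y = (Y ** A) ** Y"
    using assms(2) by (simp add: is_pinv_def)
  also have "Y ** A = transpose (Y ** (A ** X ** A))"
    using assms by (simp add: is_pinv_def)
  also have "\<dots> = transpose (X ** A) ** transpose (Y ** A)"
    by (simp add: matrix_transpose_mul[symmetric] matrix_mul_assoc)
  also have "\<dots> = X ** A ** (Y ** A)"
    using assms by (simp add: is_pinv_def)
  also have "\<dots> = X ** (A ** Y ** A)"
    by (simp add: matrix_mul_assoc)
  also have "\<dots> = X ** A"
    using assms(2) by (simp add: is_pinv_def)
  finally show ?thesis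
    using 1 by simp
qed

section \<open>Patch frameworks\<close>

definition graph_connected :: "('n \<times> 'm) set \<Rightarrow> bool" where
  "graph_connected E \<longleftrightarrow>
     (let A = {(Inl k, Inr i) | k i. (k, i) \<in> E}
      in \<forall>u v :: 'n + 'm. (u, v) \<in> (A \<union> A\<inverse>)\<^sup>*)"

definition affinely_nondegenerate_view ::
    "('n::finite \<times> 'm) set \<Rightarrow> ('n \<Rightarrow> 'm \<Rightarrow> real^'d) \<Rightarrow> 'm \<Rightarrow> bool" where
  "affinely_nondegenerate_view E x i \<longleftrightarrow>
     card {k. (k, i) \<in> E} \<ge> CARD('d) + 1 \<and>
     aff_dim (affine hull {x k i | k. (k, i) \<in> E}) = int CARD('d)"

definition edge_vec :: "'n::finite \<Rightarrow> 'm::finite \<Rightarrow> real^('n + 'm)" where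
  "edge_vec k i = axis (Inl k) 1 - axis (Inr i) 1"

definition view_block :: "'m \<Rightarrow> real^'d^('m::finite \<times> 'd::finite)" where
  "view_block i = kron_vec (axis i 1) (mat 1)"

definition laplacian :: "('n::finite \<times> 'm::finite) set \<Rightarrow> real^('n + 'm)^('n + 'm)" where
  "laplacian E = (\<Sum>(k, i)\<in>E. outer (edge_vec k i) (edge_vec k i))"

definition B_mat ::
    "('n::finite \<times> 'm::finite) set \<Rightarrow> ('n \<Rightarrow> 'm \<Rightarrow> real^'d) \<Rightarrow> real^('n + 'm)^('m \<times> 'd::finite)" where
  "B_mat E x = (\<Sum>(k, i)\<in>E. view_block i ** outer (x k i) (edge_vec k i))"

definition D_mat ::
    "('n::finite \<times> 'm::finite) set \<Rightarrow> ('n \<Rightarrow> 'm \<Rightarrow> real^'d) \<Rightarrow> real^('m \<times> 'd::finite)^('m \<times> 'd)" where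
  "D_mat E x =
     (\<Sum>(k, i)\<in>E. view_block i ** outer (x k i) (x k i) ** transpose (view_block i))"

definition C_mat ::
    "('n::finite \<times> 'm::finite) set \<Rightarrow> ('n \<Rightarrow> 'm \<Rightarrow> real^'d) \<Rightarrow> real^('m \<times> 'd::finite)^('m \<times> 'd)" where
  "C_mat E x = D_mat E x - B_mat E x ** pinv (laplacian E) ** transpose (B_mat E x)"

section \<open>Alignments\<close>

definition alignment :: "real^'d^'d^'m \<Rightarrow> bool" where
  "alignment S \<longleftrightarrow> (\<forall>i. orthogonal_matrix (S $ i))"

definition stack :: "real^'d^'d^'m \<Rightarrow> real^'d^('m::finite \<times> 'd::finite)" where
  "stack S = (\<chi> p. S $ fst p $ snd p)"

definition F_obj ::
    "('n::finite \<times> 'm::finite) set \<Rightarrow> ('n \<Rightarrow> 'm \<Rightarrow> real^'d) \<Rightarrow> real^'d^'d^'m \<Rightarrow> real" where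
  "F_obj E x S = trace (C_mat E x ** stack S ** transpose (stack S))"

definition perfect ::
    "('n::finite \<times> 'm::finite) set \<Rightarrow> ('n \<Rightarrow> 'm \<Rightarrow> real^'d) \<Rightarrow> real^'d^'d^'m \<Rightarrow> bool" where
  "perfect E x S \<longleftrightarrow> F_obj E x S = 0"

section \<open>The quotient manifold and non-degeneracy\<close>

text \<open>
  An element of \<open>O(d)\<^sup>m\<^sup>-\<^sup>1\<close> is a tuple of orthogonal matrices indexed by the views other than
  \<open>v1\<close>.  It is stored in \<open>real^'d^'d^'m\<close> with the unused block at \<open>v1\<close> equal to 0; in particular
  the manifold is a single point if \<open>v1\<close> is the only view.
\<close>

definition OM :: "'m::finite \<Rightarrow> (real^'d^'d^'m) set" where
  "OM v1 = {T. T $ v1 = 0 \<and> (\<forall>i. i \<noteq> v1 \<longrightarrow> orthogonal_matrix (T $ i))}"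

definition quot_proj :: "'m::finite \<Rightarrow> real^'d^'d^'m \<Rightarrow> real^'d^'d^'m" where
  "quot_proj v1 S = (\<chi> i. if i = v1 then 0 else S $ i ** transpose (S $ v1))"

definition prepend_id :: "'m::finite \<Rightarrow> real^'d^'d^'m \<Rightarrow> real^'d^'d^'m" where
  "prepend_id v1 T = (\<chi> i. if i = v1 then mat 1 else T $ i)"

text \<open>The defining formula makes sense, and is smooth, on all block tuples.\<close>

definition F_tilde ::
    "'m::finite \<Rightarrow> ('n::finite \<times> 'm) set \<Rightarrow> ('n \<Rightarrow> 'm \<Rightarrow> real^'d) \<Rightarrow> real^'d^'d^'m \<Rightarrow> real" where
  "F_tilde v1 E x T =
     trace (C_mat E x ** stack (prepend_id v1 T) ** transpose (stack (prepend_id v1 T)))"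

text \<open>
  The Riemannian Hessian for the metric induced by the Frobenius inner product, for a function
  \<open>f\<close> given on the ambient space of block tuples.  The tangent space at \<open>T\<close> is the kernel of
  the derivative of the defining equations \<open>T\<^sub>i\<^sup>T T\<^sub>i = I\<close>.  On the manifold, \<open>tangent_proj v1 T\<close>
  is the orthogonal projection onto it (see the two lemmas below); the
  formula also provides a smooth extension to a neighbourhood.  The Riemannian gradient is the
  tangential part of the Euclidean gradient, and the Hessian operator (Levi-Civita derivative
  of the gradient field) is the tangential part of the Euclidean derivative of an extension
  of that field.
\<close>

definition tangent_space :: "'m::finite \<Rightarrow> real^'d^'d^'m \<Rightarrow> (real^'d^'d^'m) set" where
  "tangent_space v1 T =
     {V. V $ v1 = 0 \<and>
         (\<forall>i. i \<noteq> v1 \<longrightarrow> transpose (V $ i) ** T $ i + transpose (T $ i) ** V $ i = 0)}"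

definition tangent_proj :: "'m::finite \<Rightarrow> real^'d^'d^'m \<Rightarrow> real^'d^'d^'m \<Rightarrow> real^'d^'d^'m" where
  "tangent_proj v1 T Z =
     (\<chi> i. if i = v1 then 0
           else T $ i ** ((1/2) *\<^sub>R (transpose (T $ i) ** Z $ i - transpose (Z $ i) ** T $ i)))"

definition euclidean_grad :: "('a::real_inner \<Rightarrow> real) \<Rightarrow> 'a \<Rightarrow> 'a" where
  "euclidean_grad f y = (THE g. GDERIV f y :> g)"

definition riem_grad ::
    "'m::finite \<Rightarrow> (real^'d^'d^'m \<Rightarrow> real) \<Rightarrow> real^'d^'d^'m \<Rightarrow> real^'d^'d^'m" where
  "riem_grad v1 f T = tangent_proj v1 T (euclidean_grad f T)"

definition riem_hess ::
    "'m::finite \<Rightarrow> (real^'d^'d^'m \<Rightarrow> real) \<Rightarrow> real^'d^'d^'m \<Rightarrow> real^'d^'d^'m \<Rightarrow> real^'d^'d^'m" where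
  "riem_hess v1 f T V = tangent_proj v1 T (frechet_derivative (riem_grad v1 f) (at T) V)"

definition local_minimizer_on :: "'a::topological_space set \<Rightarrow> ('a \<Rightarrow> real) \<Rightarrow> 'a \<Rightarrow> bool" where
  "local_minimizer_on M f p \<longleftrightarrow> p \<in> M \<and> (\<forall>\<^sub>F y in at p within M. f p \<le> f y)"

definition nondegenerate_local_min ::
    "'m::finite \<Rightarrow> (real^'d^'d^'m \<Rightarrow> real) \<Rightarrow> real^'d^'d^'m \<Rightarrow> bool" where
  "nondegenerate_local_min v1 f T \<longleftrightarrow>
     local_minimizer_on (OM v1) f T \<and>
     (\<forall>V\<in>tangent_space v1 T. riem_hess v1 f T V = 0 \<longrightarrow> V = 0)"

definition nondegenerate_alignment ::
    "'m::finite \<Rightarrow> ('n::finite \<times> 'm) set \<Rightarrow> ('n \<Rightarrow> 'm \<Rightarrow> real^'d) \<Rightarrow> real^'d^'d^'m \<Rightarrow> bool" where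
  "nondegenerate_alignment v1 E x S \<longleftrightarrow>
     nondegenerate_local_min v1 (F_tilde v1 E x) (quot_proj v1 S)"

lemma inner_matrix_mult_left:
  fixes A B X :: "real^'d^'d"
  shows "inner (X ** A) B = inner A (transpose X ** B)"
proof -
  have "inner (X ** A) B = (\<Sum>i\<in>UNIV. \<Sum>j\<in>UNIV. \<Sum>k\<in>UNIV. X $ i $ k * A $ k $ j * B $ i $ j)"
    by (simp add: inner_vec_def matrix_matrix_mult_def sum_distrib_right)
  also have "\<dots> = (\<Sum>i\<in>UNIV. \<Sum>k\<in>UNIV. \<Sum>j\<in>UNIV. X $ i $ k * A $ k $ j * B $ i $ j)"
    by (intro sum.cong refl sum.swap)
  also have "\<dots> = (\<Sum>k\<in>UNIV. \<Sum>i\<in>UNIV. \<Sum>j\<in>UNIV. X $ i $ k * A $ k $ j * B $ i $ j)"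
    by (rule sum.swap)
  also have "\<dots> = (\<Sum>k\<in>UNIV. \<Sum>j\<in>UNIV. \<Sum>i\<in>UNIV. X $ i $ k * A $ k $ j * B $ i $ j)"
    by (intro sum.cong refl sum.swap)
  also have "\<dots> = inner A (transpose X ** B)"
    by (simp add: inner_vec_def matrix_matrix_mult_def transpose_def sum_distrib_left mult_ac)
  finally show ?thesis .
qed

lemma inner_transpose:
  fixes A B :: "real^'d^'d"
  shows "inner (transpose A) B = inner A (transpose B)"
  unfolding inner_vec_def transpose_def by (simp, rule sum.swap)

lemma tangent_proj_in_tangent_space:
  assumes "T \<in> OM v1"
  shows "tangent_proj v1 T Z \<in> tangent_space v1 T"
proof -
  have 1: "transpose (Q ** ((1/2) *\<^sub>R W)) ** Q + transpose Q ** (Q ** ((1/2) *\<^sub>R W)) = 0"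
    if "orthogonal_matrix Q" "transpose W = - W" for Q W :: "real^'d^'d"
  proof -
    have "transpose Q ** Q = mat 1"
      using that(1) by (simp add: orthogonal_matrix)
    then have 1: "transpose Q ** (Q ** Y) = Y" for Y :: "real^'d^'d"
      by (simp add: matrix_mul_assoc)
    have 2: "transpose (Q ** Y) ** Q = transpose Y" for Y :: "real^'d^'d"
      using \<open>transpose Q ** Q = mat 1\<close>
      by (simp add: matrix_transpose_mul flip: matrix_mul_assoc)
    have "transpose ((1/2) *\<^sub>R W) = (1/2) *\<^sub>R transpose W"
      by (simp add: transpose_def vec_eq_iff)
    then have "transpose ((1/2) *\<^sub>R W) = - ((1/2) *\<^sub>R W)"
      by (simp only: that(2) scaleR_minus_right)
    then show ?thesis by (simp only: 1 2 ab_left_minus)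
  qed
  have 2: "transpose (transpose Q ** Y - transpose Y ** Q)
      = - (transpose Q ** Y - transpose Y ** Q)" for Q Y :: "real^'d^'d"
  proof -
    have "transpose (P - R) = transpose P - transpose R" for P R :: "real^'d^'d"
      by (simp add: transpose_def vec_eq_iff)
    then show ?thesis by (simp only: matrix_transpose_mul transpose_transpose minus_diff_eq)
  qed
  show ?thesis
    using assms unfolding tangent_space_def tangent_proj_def OM_def
    by (auto intro: 1 2)
qed

lemma tangent_proj_orthogonal:
  assumes "T \<in> OM v1" "V \<in> tangent_space v1 T"
  shows "inner (Z - tangent_proj v1 T Z) V = 0"
proof -
  have "inner ((Z - tangent_proj v1 T Z) $ i) (V $ i) = 0" for i
  proof (cases "i = v1")
    case True
    then show ?thesis using assms(2) by (simp add: tangent_space_def)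
  next
    case False
    define Q W A where "Q = T $ i" and "W = transpose Q ** V $ i" and "A = transpose Q ** Z $ i"
    have Q: "transpose Q ** Q = mat 1" "Q ** transpose Q = mat 1"
      using assms(1) False by (auto simp: OM_def Q_def orthogonal_matrix_def)
    have V: "V $ i = Q ** W"
      unfolding W_def by (simp add: matrix_mul_assoc Q)
    have Z: "Z $ i = Q ** A"
      unfolding A_def by (simp add: matrix_mul_assoc Q)
    have "transpose W + W = 0"
      using assms(2) False
      by (simp add: tangent_space_def W_def Q_def matrix_transpose_mul)
    then have W: "transpose W = - W"
      by (simp add: eq_neg_iff_add_eq_0)
    have T: "transpose A = transpose (Z $ i) ** Q"
      by (simp add: A_def matrix_transpose_mul)
    have "inner (Z $ i) (V $ i) = inner A W"
      unfolding Z inner_matrix_mult_left W_def ..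
    moreover have "inner (tangent_proj v1 T Z $ i) (V $ i)
        = inner ((1/2) *\<^sub>R (A - transpose A)) W"
      using False
      by (simp only: tangent_proj_def vec_lambda_beta if_False T inner_matrix_mult_left
          flip: A_def W_def Q_def)
    moreover have "inner (transpose A) W = - inner A W"
      by (simp add: inner_transpose W)
    ultimately show ?thesis
      by (simp add: inner_diff_left)
  qed
  then show ?thesis by (simp add: inner_vec_def[of _ V])
qed

section \<open>Realizations and infinitesimal rigidity\<close>

text \<open>The vector \<open>1 :: real^'n\<close> is the all-ones vector.\<close>

definition realization ::
    "('n::finite \<times> 'm::finite) set \<Rightarrow> ('n \<Rightarrow> 'm \<Rightarrow> real^'d) \<Rightarrow> real^'d^'d^'m \<Rightarrow> real^'n^'d" where
  "realization E x S =
     transpose (stack S) ** B_mat E x ** (\<chi> v k. pinv (laplacian E) $ v $ Inl k) **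
     (mat 1 - (1 / real CARD('n)) *\<^sub>R outer 1 1)"

definition trivial_motion :: "('n \<Rightarrow> real^'d) \<Rightarrow> ('n \<Rightarrow> real^'d) \<Rightarrow> bool" where
  "trivial_motion y p \<longleftrightarrow>
     (\<exists>(\<Omega> :: real^'d^'d) t. transpose \<Omega> = - \<Omega> \<and> (\<forall>k. p k = \<Omega> *v y k + t))"

definition infinitesimally_rigid :: "('n \<times> 'm) set \<Rightarrow> ('n \<Rightarrow> real^'d) \<Rightarrow> bool" where
  "infinitesimally_rigid E y \<longleftrightarrow>
     \<not> (\<exists>p :: 'n \<Rightarrow> real^'d. \<not> trivial_motion y p \<and>
          (\<forall>i k1 k2. (k1, i) \<in> E \<longrightarrow> (k2, i) \<in> E \<longrightarrow> inner (y k1 - y k2) (p k1 - p k2) = 0))"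

end

theory Submission
  imports Defs
begin

text \<open>
  \<open>Tr(C V V\<^sup>T)\<close> is the minimum over vertex positions \<open>z\<close> of
  \<open>\<Sum>\<^bsub>(k,i)\<in>E\<^esub> |z\<^sub>k - z\<^bsub>n+i\<^esub> - V\<^sub>i\<^sup>T x\<^bsub>k,i\<^esub>|\<^sup>2\<close>, so it is a nonnegative quadratic form that vanishes
  iff these equations have a solution \<open>z\<close>. At a zero of \<open>F\<close> the gradient vanishes, the Hessian is
  the restriction of the form to the tangent space, and by semidefiniteness its kernel is the
  zero set of the form. A tangent vector has blocks \<open>S\<^sub>i M\<^sub>i S\<^sub>1\<^sup>T\<close> with \<open>M\<^sub>i\<close> skew and \<open>M\<^sub>1 = 0\<close>, and
  lies in the kernel iff there are \<open>p\<^sub>k\<close>, \<open>t\<^sub>i\<close> with \<open>p\<^sub>k = M\<^sub>i y\<^sub>k + t\<^sub>i\<close> on all incidences, where \<open>y\<close> is the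
  realization. Because the views are affinely non-degenerate, the infinitesimal motions of \<open>y\<close> are
  exactly the \<open>p\<close> of this shape, up to a global skew map which normalizes \<open>M\<^sub>1\<close> to \<open>0\<close>; connectedness
  makes the motion trivial when all \<open>M\<^sub>i\<close> vanish.
\<close>

section \<open>Matrices and the pseudoinverse\<close>

text \<open>As a simp rule it would turn \<open>transpose A *v v\<close> into \<open>v v* A\<close>,
  hiding products from the rules for \<open>*v\<close>.\<close>

declare transpose_matrix_vector [simp del]

lemma bilinear_matrix_mul:
  "bilinear ((**) :: real^'b::finite^'a::finite \<Rightarrow> real^'c::finite^'b \<Rightarrow> real^'c^'a)"
  unfolding bilinear_def linear_iff
  by (auto simp: matrix_matrix_mult_def vec_eq_iff algebra_simps sum.distrib sum_distrib_left)

text \<open>Supplies the distributive, summation and differentiation rules for \<open>**\<close>;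
  the next interpretation does the same for \<open>*v\<close>.\<close>

interpretation matrix_mul: bounded_bilinear
  "(**) :: real^'b::finite^'a::finite \<Rightarrow> real^'c::finite^'b \<Rightarrow> real^'c^'a"
  using bilinear_matrix_mul bilinear_conv_bounded_bilinear by blast

interpretation matrix_vector_mul: bounded_bilinear
  "(*v) :: real^'b::finite^'a::finite \<Rightarrow> real^'b \<Rightarrow> real^'a"
proof (subst bilinear_conv_bounded_bilinear[symmetric])
  show "bilinear ((*v) :: real^'b^'a \<Rightarrow> real^'b \<Rightarrow> real^'a)"
    unfolding bilinear_def linear_iff
    by (auto simp: matrix_vector_mult_def vec_eq_iff algebra_simps sum.distrib sum_distrib_left)
qed

lemma linear_transpose: "linear (transpose :: real^'b^'a \<Rightarrow> real^'a^'b)"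
  by (simp add: linear_iff transpose_def vec_eq_iff)

lemma inner_transpose_transpose:
  fixes A B :: "real^'b^'a"
  shows "inner (transpose A) (transpose B) = inner A B"
  unfolding inner_vec_def transpose_def by (simp, rule sum.swap)

lemma trace_mul_transpose:
  fixes A B :: "real^'b^'a"
  shows "trace (A ** transpose B) = inner A B"
  by (simp add: trace_def matrix_matrix_mult_def transpose_def inner_vec_def)

lemma inner_mul_right:
  fixes A :: "real^'b^'a" and X :: "real^'c^'b"
  shows "inner (A ** X) Y = inner A (Y ** transpose X)"
proof -
  have "trace (A ** X ** transpose Y) = trace (A ** transpose (Y ** transpose X))"
    by (simp add: matrix_transpose_mul matrix_mul_assoc)
  then show ?thesis by (simp only: trace_mul_transpose)
qed

lemma inner_mul_left:
  fixes A :: "real^'b^'a" and X :: "real^'a^'c"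
  shows "inner (X ** A) Y = inner A (transpose X ** Y)"
proof -
  have "inner (X ** A) Y = inner (transpose A ** transpose X) (transpose Y)"
    by (metis inner_transpose_transpose matrix_transpose_mul)
  also have "\<dots> = inner (transpose A) (transpose (transpose X ** Y))"
    by (simp add: inner_mul_right matrix_transpose_mul)
  finally show ?thesis by (simp only: inner_transpose_transpose)
qed

lemma inner_matrix_vector_left:
  fixes A :: "real^'b^'a"
  shows "inner (A *v u) v = inner u (transpose A *v v)"
  by (metis dot_lmul_matrix inner_commute transpose_matrix_vector)

lemma inner_outer: "inner (outer u v) A = inner u (A *v v)"
  by (simp add: outer_def inner_vec_def matrix_vector_mult_def sum_distrib_left mult_ac)

lemma matrix_mul_outer: "A ** outer u v = outer (A *v u) v"
  by (simp add: outer_def matrix_matrix_mult_def matrix_vector_mult_def vec_eq_iff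
      sum_distrib_left mult_ac)

lemma outer_mul_matrix: "outer u v ** A = outer u (transpose A *v v)"
  unfolding outer_def matrix_matrix_mult_def matrix_vector_mult_def transpose_def
  by (simp add: vec_eq_iff sum_distrib_left mult_ac)

lemma transpose_outer: "transpose (outer u v) = outer v u"
  by (simp add: outer_def transpose_def vec_eq_iff mult_ac)

lemma orthogonal_matrix_cancel:
  fixes Q :: "real^'d^'d"
  assumes "orthogonal_matrix Q"
  shows "transpose Q ** Q = mat 1" "Q ** transpose Q = mat 1"
    "transpose Q *v (Q *v v) = v" "Q *v (transpose Q *v v) = v"
  using assms by (simp_all add: orthogonal_matrix_def matrix_vector_mul_assoc)

text \<open>For an orthonormal basis of \<open>W\<close>, the sum of the matrices
  \<open>outer b b\<close> is the orthogonal projection onto \<open>W\<close>.\<close>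

lemma symmetric_projection_exists:
  fixes W :: "(real^'n) set"
  assumes "subspace W"
  shows "\<exists>P :: real^'n^'n. transpose P = P \<and> (\<forall>v. P *v v \<in> W) \<and> (\<forall>v\<in>W. P *v v = v)"
proof -
  obtain B where B: "B \<subseteq> W" "pairwise orthogonal B" "\<And>b. b \<in> B \<Longrightarrow> norm b = 1"
    "independent B" "span B = W"
    using orthonormal_basis_subspace[OF assms] by metis
  have fin: "finite B" using B(4) by (simp add: independent_imp_finite)
  define P where "P = (\<Sum>b\<in>B. outer b b)"
  have Pv: "P *v v = (\<Sum>b\<in>B. inner b v *\<^sub>R b)" for v
  proof -
    have "outer b b *v v = inner b v *\<^sub>R b" for b
      by (simp add: outer_def matrix_vector_mult_def inner_vec_def vec_eq_iff
          sum_distrib_left mult_ac)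
    then show ?thesis by (simp add: P_def matrix_vector_mul.sum_left)
  qed
  have "P *v v = v" if "v \<in> span B" for v
    using that
  proof (rule span_induct)
    show "subspace {v. P *v v = v}"
      by (simp add: subspace_def matrix_vector_mul.add_right matrix_vector_mul.scaleR_right)
  next
    fix b assume b: "b \<in> B"
    have "inner c b *\<^sub>R c = (if c = b then b else 0)" if "c \<in> B" for c
      using B(2,3) that b by (auto simp: pairwise_def orthogonal_def norm_eq_1)
    then show "P *v b = b" by (simp add: Pv b fin)
  qed
  moreover have "P *v v \<in> W" for v
    unfolding Pv using B(1) assms by (intro subspace_sum subspace_scale) auto
  moreover have "transpose P = P"
    by (simp add: P_def linear_sum[OF linear_transpose] transpose_outer)
  ultimately show ?thesis using B(5) by blast
qed

text \<open>With \<open>P\<close> the orthogonal projection onto the kernel of \<open>A\<close>, the pseudoinverse is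
  \<open>(A + P)\<^sup>-\<^sup>1 - P\<close>.\<close>

lemma symmetric_is_pinv_exists:
  fixes A :: "real^'n^'n"
  assumes A: "transpose A = A"
  shows "\<exists>X. is_pinv A X"
proof -
  have "subspace {v. A *v v = 0}"
    by (simp add: subspace_def matrix_vector_mul.add_right matrix_vector_mul.scaleR_right)
  then obtain P where P: "transpose P = P" "\<And>v. A *v (P *v v) = 0"
    and Pid: "\<And>v. A *v v = 0 \<Longrightarrow> P *v v = v"
    using symmetric_projection_exists by blast
  have AP: "A ** P = 0"
    using P(2) by (simp add: matrix_eq matrix_vector_mul_assoc)
  have PA: "P ** A = 0"
    using arg_cong[OF AP, of transpose] by (simp add: matrix_transpose_mul A P(1) linear_0[OF linear_transpose])
  have PP: "P ** P = P"
    using P(2) Pid by (simp add: matrix_eq flip: matrix_vector_mul_assoc)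
  \<comment> \<open>Since \<open>P ** A = 0\<close>, applying \<open>P\<close> separates the
    summands: both \<open>A\<close> and \<open>P\<close> kill \<open>v\<close>, while
    \<open>P\<close> fixes the kernel of \<open>A\<close>.\<close>
  have ker: "v = 0" if v: "(A + P) *v v = 0" for v
  proof -
    have "P *v ((A + P) *v v) = P *v v"
      by (simp add: matrix_vector_mul_assoc matrix_mul.add_right PA PP)
    then have "P *v v = 0" using v by simp
    moreover from this have "A *v v = 0" using v by (simp add: matrix_vector_mul.add_left)
    ultimately show ?thesis using Pid by simp
  qed
  then obtain R where R: "R ** (A + P) = mat 1" using matrix_left_invertible_ker by blast
  then have R': "(A + P) ** R = mat 1" using matrix_left_right_inverse by blast
  have RP: "R ** P = P"
  proof -
    have "R ** P = R ** ((A + P) ** P)" by (simp add: matrix_mul.add_left AP PP)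
    then show ?thesis by (simp add: matrix_mul_assoc R)
  qed
  have PR: "P ** R = P"
  proof -
    have "P ** R = (P ** (A + P)) ** R" by (simp add: matrix_mul.add_right PA PP)
    then show ?thesis by (simp add: R' flip: matrix_mul_assoc)
  qed
  define X where "X = R - P"
  have AX: "A ** X = mat 1 - P"
    using R' by (simp add: X_def matrix_mul.diff_right AP matrix_mul.add_left PR algebra_simps)
  have XA: "X ** A = mat 1 - P"
    using R by (simp add: X_def matrix_mul.diff_left PA matrix_mul.add_right RP algebra_simps)
  have "is_pinv A X"
    unfolding is_pinv_def AX XA
    by (simp add: matrix_mul.diff_left PA linear_diff[OF linear_transpose] P(1))
       (simp add: X_def matrix_mul.diff_right PR PP)
  then show ?thesis ..
qed

lemma is_pinv_pinv:
  assumes "\<exists>X. is_pinv A X"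
  shows "is_pinv A (pinv A)"
  unfolding pinv_def using assms by (metis is_pinv_unique theI)

text \<open>For symmetric \<open>A\<close> the Penrose equations are stable under transposing
  \<open>X\<close>, so uniqueness applies.\<close>

lemma transpose_pinv:
  fixes A :: "real^'n^'n"
  assumes A: "transpose A = A"
  shows "transpose (pinv A) = pinv A"
proof (rule is_pinv_unique)
  show P: "is_pinv A (pinv A)"
    by (intro is_pinv_pinv symmetric_is_pinv_exists A)
  show "is_pinv A (transpose (pinv A))"
    using P unfolding is_pinv_def
    by (metis A matrix_mul_assoc matrix_transpose_mul transpose_transpose)
qed

section \<open>The objective as a least-squares energy\<close>

lemma transpose_laplacian: "transpose (laplacian E) = laplacian E"
  by (simp add: laplacian_def linear_sum[OF linear_transpose] transpose_outer case_prod_unfold)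

lemmas laplacian_pinv =
  is_pinv_pinv[OF symmetric_is_pinv_exists[OF transpose_laplacian], unfolded is_pinv_def]

text \<open>\<open>view_block i\<close> embeds the block of view \<open>i\<close>, so its transpose
  extracts it. This turns the Kronecker formulas for \<open>B_mat\<close> and \<open>D_mat\<close>
  into plain sums over incidences.\<close>

lemma stack_mul_view_block:
  fixes V :: "real^'d^'d^'m"
  shows "transpose (view_block i) ** stack V = V $ i"
proof -
  have "(transpose (view_block i) ** stack V) $ a $ b = V $ i $ a $ b" for a b
  proof -
    have "(transpose (view_block i) ** stack V) $ a $ b
      = (\<Sum>p\<in>UNIV. (if p = (i, a) then V $ i $ a $ b else 0))"
      by (auto intro!: sum.cong simp: matrix_matrix_mult_def transpose_def view_block_def
          kron_vec_def stack_def mat_def axis_def prod_eq_iff)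
    then show ?thesis by simp
  qed
  then show ?thesis by (simp add: vec_eq_iff)
qed

lemma transpose_stack_mul_view_block:
  fixes V :: "real^'d^'d^'m"
  shows "transpose (stack V) ** view_block i = transpose (V $ i)"
  using arg_cong[OF stack_mul_view_block, of transpose] by (simp add: matrix_transpose_mul)

text \<open>This is the right-hand side of the normal equations
  \<open>Z ** laplacian E = transpose (stack V) ** B_mat E x\<close>.\<close>

lemma transpose_stack_mul_B:
  "transpose (stack V) ** B_mat E x =
     (\<Sum>(k, i)\<in>E. outer (transpose (V $ i) *v x k i) (edge_vec k i))"
  unfolding B_mat_def
  by (simp add: matrix_mul.sum_right case_prod_unfold matrix_mul_assoc
      transpose_stack_mul_view_block)
    (simp add: matrix_mul_outer)

lemma mul_laplacian:
  "Z ** laplacian E = (\<Sum>(k, i)\<in>E. outer (Z *v edge_vec k i) (edge_vec k i))"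
  unfolding laplacian_def
  by (simp add: matrix_mul.sum_right case_prod_unfold matrix_mul_outer)

lemma inner_D:
  fixes V :: "real^'d^'d^'m"
  shows "inner (D_mat E x ** stack V) (stack V) = (\<Sum>(k, i)\<in>E. (norm (transpose (V $ i) *v x k i))\<^sup>2)"
proof -
  have "inner (view_block i ** outer u u ** transpose (view_block i) ** stack V) (stack V)
     = (norm (transpose (V $ i) *v u))\<^sup>2" for u :: "real^'d" and i :: 'm
  proof -
    have "inner (view_block i ** outer u u ** transpose (view_block i) ** stack V) (stack V)
      = inner (outer u u ** (transpose (view_block i) ** stack V)) (transpose (view_block i) ** stack V)"
      by (simp add: inner_mul_left flip: matrix_mul_assoc)
    also have "\<dots> = inner u (V $ i *v (transpose (V $ i) *v u))"
      by (simp only: stack_mul_view_block outer_mul_matrix inner_outer)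
    also have "\<dots> = inner (transpose (V $ i) *v u) (transpose (V $ i) *v u)"
      by (metis inner_matrix_vector_left inner_commute)
    finally show ?thesis by (simp only: power2_norm_eq_inner)
  qed
  then show ?thesis
    unfolding D_mat_def
    by (simp add: matrix_mul.sum_left inner_sum_left case_prod_unfold)
qed

text \<open>Expanding the squares, the quadratic, mixed and constant terms sum to the contributions
  of \<open>laplacian\<close>, \<open>B_mat\<close> and \<open>D_mat\<close>. The columns of
  \<open>Z\<close> are arbitrary vertex positions.\<close>

lemma energy_expansion:
  "(\<Sum>(k, i)\<in>E. (norm (Z *v edge_vec k i - transpose (V $ i) *v x k i))\<^sup>2) =
     inner (Z ** laplacian E) Z - 2 * inner (transpose (stack V) ** B_mat E x) Z
     + inner (D_mat E x ** stack V) (stack V)"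
  unfolding inner_D mul_laplacian transpose_stack_mul_B
  by (simp add: inner_sum_left case_prod_unfold inner_outer sum_distrib_left power2_norm_eq_inner
      flip: sum_subtractf sum.distrib)
    (simp add: inner_diff_left inner_diff_right inner_commute algebra_simps)

lemma F_obj_inner: "F_obj E x V = inner (C_mat E x ** stack V) (stack V)"
  by (simp add: F_obj_def trace_mul_transpose)

text \<open>The vertex positions of minimal energy for given \<open>V\<close>.\<close>

definition opt_pos where
  "opt_pos E x V = transpose (stack V) ** B_mat E x ** pinv (laplacian E)"

lemma F_obj_pinv:
  "F_obj E x V = inner (D_mat E x ** stack V) (stack V)
     - inner (transpose (stack V) ** B_mat E x) (opt_pos E x V)"
proof -
  have "inner (B_mat E x ** pinv (laplacian E) ** transpose (B_mat E x) ** stack V) (stack V)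
    = inner (pinv (laplacian E) ** (transpose (B_mat E x) ** stack V)) (transpose (B_mat E x) ** stack V)"
    by (simp add: inner_mul_left flip: matrix_mul_assoc)
  also have "\<dots> = inner (transpose (pinv (laplacian E) ** (transpose (B_mat E x) ** stack V)))
     (transpose (transpose (B_mat E x) ** stack V))"
    by (simp only: inner_transpose_transpose)
  also have "\<dots> = inner (opt_pos E x V) (transpose (stack V) ** B_mat E x)"
    by (simp add: opt_pos_def matrix_transpose_mul transpose_pinv transpose_laplacian)
  finally show ?thesis
    by (simp add: F_obj_inner C_mat_def matrix_mul.diff_left inner_diff_left inner_commute[of "opt_pos E x V"])
qed

text \<open>The Penrose identity \<open>X ** A ** X = X\<close> makes the quadratic term at
  \<open>opt_pos\<close> equal to the mixed inner product, so the expansion collapses to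
  \<open>F_obj_pinv\<close>.\<close>

lemma F_obj_eq_energy:
  "F_obj E x V =
     (\<Sum>(k, i)\<in>E. (norm (opt_pos E x V *v edge_vec k i - transpose (V $ i) *v x k i))\<^sup>2)"
proof -
  have "opt_pos E x V ** laplacian E ** pinv (laplacian E) = opt_pos E x V"
    using laplacian_pinv[of E] by (simp add: opt_pos_def flip: matrix_mul_assoc)
  then have "inner (opt_pos E x V ** laplacian E) (opt_pos E x V) =
    inner (transpose (stack V) ** B_mat E x) (opt_pos E x V)"
    using inner_mul_right[of "transpose (stack V) ** B_mat E x" "pinv (laplacian E)"
       "opt_pos E x V ** laplacian E"]
    by (simp add: transpose_pinv transpose_laplacian inner_commute flip: opt_pos_def)
  then show ?thesis by (simp add: energy_expansion F_obj_pinv)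
qed

lemma F_obj_nonneg: "F_obj E x V \<ge> 0"
  unfolding F_obj_eq_energy by (auto intro!: sum_nonneg)

lemma opt_pos_edge:
  assumes "F_obj E x V = 0" "(k, i) \<in> E"
  shows "opt_pos E x V *v edge_vec k i = transpose (V $ i) *v x k i"
proof -
  have "\<forall>(k, i)\<in>E. (norm (opt_pos E x V *v edge_vec k i - transpose (V $ i) *v x k i))\<^sup>2 = 0"
    using assms(1) unfolding F_obj_eq_energy
    by (subst (asm) sum_nonneg_eq_0_iff) (auto)
  then show ?thesis using assms(2) by auto
qed

lemma matrix_mul_edge_vec: "Z *v edge_vec k i = column (Inl k) Z - column (Inr i) Z"
  by (simp add: edge_vec_def matrix_vector_mul.diff_right matrix_vector_mult_basis)

text \<open>At zero energy the columns of \<open>opt_pos\<close> solve the system. Conversely, a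
  solution satisfies the normal equations, and \<open>A ** X ** A = A\<close> then makes the term
  subtracted in \<open>F_obj_pinv\<close> equal to the \<open>D_mat\<close> term.\<close>

lemma F_obj_eq_0_iff:
  fixes V :: "real^'d^'d^'m"
  shows "F_obj E x V = 0 \<longleftrightarrow>
    (\<exists>z. \<forall>(k, i)\<in>E. z (Inl k) - z (Inr i) = transpose (V $ i) *v x k i)" (is "_ \<longleftrightarrow> ?R")
proof
  assume "F_obj E x V = 0"
  then show ?R
    by (intro exI[of _ "\<lambda>v. column v (opt_pos E x V)"])
      (auto simp: opt_pos_edge simp flip: matrix_mul_edge_vec)
next
  assume ?R
  then obtain z where z: "\<And>k i. (k, i) \<in> E \<Longrightarrow> z (Inl k) - z (Inr i) = transpose (V $ i) *v x k i"
    by blast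
  define Z where "Z = (\<chi> c v. z v $ c)"
  have Z: "Z *v edge_vec k i = transpose (V $ i) *v x k i" if "(k, i) \<in> E" for k i
    using z[OF that] unfolding matrix_mul_edge_vec by (simp add: Z_def column_def)
  let ?L = "laplacian E"
  have ZL: "transpose (stack V) ** B_mat E x = Z ** ?L"
    unfolding transpose_stack_mul_B mul_laplacian
    by (auto intro!: sum.cong simp: Z)
  have "inner (Z ** ?L) (opt_pos E x V) = inner (Z ** (?L ** pinv ?L ** ?L)) Z"
    unfolding opt_pos_def ZL
    by (metis inner_commute inner_mul_right matrix_mul_assoc transpose_laplacian)
  also have "\<dots> = inner (Z ** ?L) Z"
    by (simp only: laplacian_pinv)
  also have "\<dots> = (\<Sum>(k, i)\<in>E. (norm (Z *v edge_vec k i))\<^sup>2)"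
    unfolding mul_laplacian
    by (simp add: inner_sum_left case_prod_unfold inner_outer power2_norm_eq_inner)
  also have "\<dots> = inner (D_mat E x ** stack V) (stack V)"
    unfolding inner_D by (auto intro!: sum.cong simp: Z)
  finally show "F_obj E x V = 0" by (simp add: F_obj_pinv ZL)
qed

section \<open>The Hessian at a perfect alignment\<close>

text \<open>Basis vectors are of the form \<open>axis i u\<close>, so blocks suffice; meant for
  \<open>tangent_proj\<close>, which is given block by block.\<close>

lemma has_derivative_vec:
  fixes f :: "'a::real_normed_vector \<Rightarrow> 'b::euclidean_space^'n"
  assumes "\<And>i. ((\<lambda>x. f x $ i) has_derivative (\<lambda>h. f' h $ i)) (at a within S)"
  shows "(f has_derivative f') (at a within S)"
proof (subst has_derivative_componentwise_within, intro ballI)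
  fix b :: "'b^'n" assume "b \<in> Basis"
  then obtain i u where "b = axis i u" by (auto simp: Basis_vec_def)
  then show "((\<lambda>x. inner (f x) b) has_derivative (\<lambda>h. inner (f' h) b)) (at a within S)"
    by (simp add: inner_axis has_derivative_inner_left assms)
qed

lemma linear_stack: "linear (stack :: real^'d^'d^'m \<Rightarrow> _)"
  by (simp add: linear_iff stack_def vec_eq_iff)

definition unstack :: "real^'d^('m \<times> 'd) \<Rightarrow> real^'d^'d^'m" where
  "unstack M = (\<chi> i c. M $ (i, c))"

lemma linear_unstack: "linear unstack"
  by (simp add: linear_iff unstack_def vec_eq_iff)

lemma inner_stack: "inner (stack V) M = inner V (unstack M)"
proof -
  have "inner (stack V) M = (\<Sum>p\<in>UNIV \<times> UNIV. inner (V $ fst p $ snd p) (M $ p))"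
    by (simp only: inner_vec_def[of "stack V"] UNIV_Times_UNIV) (simp add: stack_def)
  also have "\<dots> = (\<Sum>i\<in>UNIV. \<Sum>c\<in>UNIV. inner (V $ i $ c) (M $ (i, c)))"
    by (subst sum.cartesian_product) (simp add: case_prod_unfold)
  finally show ?thesis
    by (simp add: inner_vec_def[of V] inner_vec_def[of "V $ _"] unstack_def)
qed

text \<open>The sum with the transpose gives the gradient without a symmetry proof for
  \<open>C_mat\<close>.\<close>

definition F_obj_grad where
  "F_obj_grad E x V = unstack ((C_mat E x + transpose (C_mat E x)) ** stack V)"

lemma linear_F_obj_grad: "linear (F_obj_grad E x)"
  unfolding F_obj_grad_def
  by (intro linear_compose[OF linear_stack, unfolded o_def] linear_compose[OF _ linear_unstack, unfolded o_def])
    (simp add: linear_iff matrix_mul.add_right matrix_mul.scaleR_right)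

lemma GDERIV_F_obj: "GDERIV (F_obj E x) V :> F_obj_grad E x V"
proof -
  have st: "(stack has_derivative stack) (at V)"
    using linear_stack linear_conv_bounded_linear bounded_linear_imp_has_derivative by blast
  let ?C = "C_mat E x"
  have "(F_obj E x has_derivative
     (\<lambda>W. inner (?C ** stack V) (stack W) + inner (?C ** stack W) (stack V))) (at V)"
    unfolding F_obj_inner[abs_def]
    using has_derivative_inner[OF bounded_linear.has_derivative
        [OF matrix_mul.bounded_linear_right st] st]
    by simp
  moreover have "inner (?C ** stack V) (stack W) + inner (?C ** stack W) (stack V)
      = inner W (F_obj_grad E x V)" for W
    by (simp add: F_obj_grad_def matrix_mul.add_left inner_add_right
        inner_mul_left[of "?C" "stack W"] inner_commute[of "?C ** stack V"] flip: inner_stack)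
  ultimately show ?thesis by (simp add: gderiv_def)
qed

text \<open>Euler's identity for a form homogeneous of degree 2.\<close>

lemma F_obj_eq_inner_grad: "inner V (F_obj_grad E x V) = 2 * F_obj E x V"
proof -
  have "inner V (F_obj_grad E x V) =
    inner (stack V) (C_mat E x ** stack V) + inner (stack V) (transpose (C_mat E x) ** stack V)"
    by (simp add: F_obj_grad_def matrix_mul.add_left inner_add_right flip: inner_stack)
  also have "inner (stack V) (transpose (C_mat E x) ** stack V) = F_obj E x V"
    by (simp add: F_obj_inner inner_mul_left)
  finally show ?thesis by (simp add: F_obj_inner inner_commute)
qed

text \<open>A zero of a nonnegative function is a global minimum. Used both at the critical point
  and for tangent vectors, where it puts zeros of the form into the kernel of the Hessian.\<close>

lemma F_obj_grad_eq_0: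
  assumes "F_obj E x V = 0"
  shows "F_obj_grad E x V = 0"
proof -
  have "(\<lambda>h. inner h (F_obj_grad E x V)) = (\<lambda>h. 0)"
    by (rule differential_zero_maxmin[of V UNIV "F_obj E x"])
      (use GDERIV_F_obj[of E x V] assms F_obj_nonneg in \<open>auto simp: gderiv_def\<close>)
  then show ?thesis by (metis inner_eq_zero_iff)
qed

text \<open>The linear part of the affine map \<open>prepend_id v1\<close>.\<close>

definition zero_block :: "'m \<Rightarrow> real^'d^'d^'m \<Rightarrow> real^'d^'d^'m" where
  "zero_block v1 V = (\<chi> i. if i = v1 then 0 else V $ i)"

lemma linear_zero_block: "linear (zero_block v1)"
  by (simp add: linear_iff zero_block_def vec_eq_iff)

lemma inner_zero_block: "inner (zero_block v1 V) W = inner V (zero_block v1 W)"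
  by (simp add: inner_vec_def[of _ W] inner_vec_def[of V] zero_block_def if_distrib if_distribR
     cong: if_cong)

lemma has_derivative_prepend_id: "(prepend_id v1 has_derivative zero_block v1) (at T)"
proof -
  have eq: "prepend_id v1 0 + zero_block v1 T = prepend_id v1 T" for T
    by (auto simp: prepend_id_def zero_block_def vec_eq_iff)
  have "(zero_block v1 has_derivative zero_block v1) (at T)"
    using linear_zero_block linear_conv_bounded_linear bounded_linear_imp_has_derivative by blast
  then have "((\<lambda>T. prepend_id v1 0 + zero_block v1 T) has_derivative zero_block v1) (at T)"
    using has_derivative_add[OF has_derivative_const] by fastforce
  then show ?thesis by (simp add: eq)
qed

lemma F_tilde_eq: "F_tilde v1 E x T = F_obj E x (prepend_id v1 T)"
  by (simp add: F_tilde_def F_obj_def)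

lemma euclidean_grad_eqI:
  assumes "GDERIV f y :> g"
  shows "euclidean_grad f y = g"
  unfolding euclidean_grad_def
proof (rule the_equality)
  show "GDERIV f y :> g" by fact
next
  fix g' assume "GDERIV f y :> g'"
  with assms have "(\<lambda>h. inner h g') = (\<lambda>h. inner h g)"
    unfolding gderiv_def by (rule has_derivative_unique[rotated])
  then have "inner h (g' - g) = 0" for h
    by (metis inner_diff_right right_minus_eq)
  then show "g' = g" by (metis inner_eq_zero_iff right_minus_eq)
qed

text \<open>The chain rule inserts the self-adjoint \<open>zero_block v1\<close>, which
  \<open>tangent_proj\<close> absorbs because it ignores block \<open>v1\<close>.\<close>

lemma riem_grad_F_tilde:
  "riem_grad v1 (F_tilde v1 E x) T = tangent_proj v1 T (F_obj_grad E x (prepend_id v1 T))"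
proof -
  have "GDERIV (F_tilde v1 E x) T :> zero_block v1 (F_obj_grad E x (prepend_id v1 T))"
    using has_derivative_compose[OF has_derivative_prepend_id GDERIV_F_obj[unfolded gderiv_def]]
    unfolding gderiv_def F_tilde_eq[abs_def] inner_zero_block .
  then have "riem_grad v1 (F_tilde v1 E x) T
      = tangent_proj v1 T (zero_block v1 (F_obj_grad E x (prepend_id v1 T)))"
    by (simp only: riem_grad_def euclidean_grad_eqI)
  then show ?thesis by (simp add: tangent_proj_def zero_block_def vec_eq_iff)
qed

text \<open>Where the field \<open>G\<close> vanishes, the dependence of the projection on the base point does not
  contribute to the derivative.\<close>

lemma has_derivative_tangent_proj:
  fixes G G' :: "real^'d^'d^'m \<Rightarrow> real^'d^'d^'m"
  assumes G: "(G has_derivative G') (at T)" and "G T = 0"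
  shows "((\<lambda>T. tangent_proj v1 T (G T)) has_derivative (\<lambda>V. tangent_proj v1 T (G' V))) (at T)"
proof (rule has_derivative_vec)
  fix i
  have nth: "((\<lambda>T. T $ i) has_derivative (\<lambda>V. V $ i)) (at T)"
    by (intro bounded_linear_imp_has_derivative bounded_linear_vec_nth)
  have Gi: "((\<lambda>T. G T $ i) has_derivative (\<lambda>V. G' V $ i)) (at T)"
    by (rule bounded_linear.has_derivative[OF bounded_linear_vec_nth G])
  have tr: "bounded_linear (transpose :: real^'d^'d \<Rightarrow> real^'d^'d)"
    using linear_transpose linear_conv_bounded_linear by blast
  note d = has_derivative_scaleR_right has_derivative_diff matrix_mul.FDERIV
    bounded_linear.has_derivative[OF tr] nth Gi
  show "((\<lambda>T. tangent_proj v1 T (G T) $ i) has_derivative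
      (\<lambda>V. tangent_proj v1 T (G' V) $ i)) (at T)"
  proof (cases "i = v1")
    case True
    then show ?thesis by (simp add: tangent_proj_def)
  next
    case False
    have "((\<lambda>T. T $ i ** ((1/2) *\<^sub>R (transpose (T $ i) ** G T $ i - transpose (G T $ i) ** T $ i)))
       has_derivative
       (\<lambda>V. T $ i ** ((1/2) *\<^sub>R (transpose (T $ i) ** G' V $ i - transpose (G' V $ i) ** T $ i)))) (at T)"
      by (rule has_derivative_eq_rhs, (rule d)+)
        (simp add: assms(2) linear_0[OF linear_transpose])
    then show ?thesis using False by (simp add: tangent_proj_def)
  qed
qed

lemma tangent_proj_0: "tangent_proj v1 T 0 = 0"
  by (simp add: tangent_proj_def vec_eq_iff[of _ 0] linear_0[OF linear_transpose])

text \<open>One projection comes from \<open>riem_grad\<close>, the other from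
  \<open>riem_hess\<close>. In between, the linear map \<open>F_obj_grad E x\<close> is its own
  derivative.\<close>

lemma riem_hess_F_tilde:
  assumes "F_tilde v1 E x T = 0" "V $ v1 = 0"
  shows "riem_hess v1 (F_tilde v1 E x) T V = tangent_proj v1 T (tangent_proj v1 T (F_obj_grad E x V))"
proof -
  have "((\<lambda>T. F_obj_grad E x (prepend_id v1 T)) has_derivative
      (\<lambda>V. F_obj_grad E x (zero_block v1 V))) (at T)"
    using linear_F_obj_grad linear_conv_bounded_linear has_derivative_prepend_id
    by (blast intro: bounded_linear.has_derivative)
  then have "(riem_grad v1 (F_tilde v1 E x) has_derivative
     (\<lambda>V. tangent_proj v1 T (F_obj_grad E x (zero_block v1 V)))) (at T)"
    unfolding riem_grad_F_tilde[abs_def]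
    by (rule has_derivative_tangent_proj) (use assms in \<open>simp add: F_tilde_eq F_obj_grad_eq_0\<close>)
  then have "frechet_derivative (riem_grad v1 (F_tilde v1 E x)) (at T)
     = (\<lambda>V. tangent_proj v1 T (F_obj_grad E x (zero_block v1 V)))"
    by (rule frechet_derivative_at[symmetric])
  moreover have "zero_block v1 V = V"
    using assms(2) by (simp add: zero_block_def vec_eq_iff)
  ultimately show ?thesis by (simp add: riem_hess_def)
qed

lemma nondegenerate_local_min_F_tilde_iff:
  assumes T: "T \<in> OM v1" and F0: "F_tilde v1 E x T = 0"
  shows "nondegenerate_local_min v1 (F_tilde v1 E x) T \<longleftrightarrow>
    (\<forall>V\<in>tangent_space v1 T. F_obj E x V = 0 \<longrightarrow> V = 0)"
proof -
  have "local_minimizer_on (OM v1) (F_tilde v1 E x) T"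
    using T F0 by (simp add: local_minimizer_on_def F_tilde_eq F_obj_nonneg)
  moreover have "riem_hess v1 (F_tilde v1 E x) T V = 0 \<longleftrightarrow> F_obj E x V = 0"
    if V: "V \<in> tangent_space v1 T" for V
  proof -
    let ?H = "F_obj_grad E x V"
    have hess: "riem_hess v1 (F_tilde v1 E x) T V = tangent_proj v1 T (tangent_proj v1 T ?H)"
      using V by (intro riem_hess_F_tilde F0) (simp add: tangent_space_def)
    have "inner (tangent_proj v1 T (tangent_proj v1 T ?H)) V = 2 * F_obj E x V"
      using tangent_proj_orthogonal[OF T V, of ?H]
        tangent_proj_orthogonal[OF T V, of "tangent_proj v1 T ?H"]
      by (simp add: inner_diff_right inner_commute[of _ V] flip: F_obj_eq_inner_grad)
    then show ?thesis
      unfolding hess by (auto simp: F_obj_grad_eq_0 tangent_proj_0)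
  qed
  ultimately show ?thesis by (auto simp: nondegenerate_local_min_def)
qed

section \<open>Infinitesimal motions\<close>

text \<open>The vectors on which \<open>M - N\<close> takes its value at \<open>x0\<close> form an
  affine set containing \<open>X\<close>, hence everything; comparing with the vector 0 gives the
  claim.\<close>

lemma matrix_eq_if_affine_hull_UNIV:
  fixes M N :: "real^'b^'a"
  assumes hull: "affine hull X = UNIV"
    and eq: "\<And>u v. u \<in> X \<Longrightarrow> v \<in> X \<Longrightarrow> M *v (u - v) = N *v (u - v)"
  shows "M = N"
proof -
  obtain x0 where x0: "x0 \<in> X" using hull by fastforce
  define A where "A = {v. (M - N) *v v = (M - N) *v x0}"
  have "affine A"
    by (auto simp: A_def affine_def matrix_vector_mul.add_right matrix_vector_mul.scaleR_right
        simp flip: scaleR_left.add)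
  moreover have "X \<subseteq> A"
    using eq[OF _ x0] by (auto simp: A_def matrix_vector_mul.diff_right matrix_vector_mul.diff_left
       algebra_simps)
  ultimately have "A = UNIV" using hull by (metis hull_minimal top.extremum_uniqueI)
  then have const: "(M - N) *v v = (M - N) *v x0" for v by (auto simp: A_def)
  have "(M - N) *v v = 0" for v using const[of v] const[of 0] by simp
  then show ?thesis by (simp add: matrix_eq matrix_vector_mul.diff_left)
qed

text \<open>The span of the pairs \<open>(y\<^sub>k - y\<^sub>0, p\<^sub>k - p\<^sub>0)\<close> is isotropic for the form
  \<open>(a, b), (c, d) \<mapsto> \<langle>a, d\<rangle> + \<langle>b, c\<rangle>\<close> and projects onto the first factor, hence it is the graph
  of a skew-symmetric map.\<close>

lemma isometric_velocities_skew:
  fixes y p :: "'k \<Rightarrow> real^'d"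
  assumes hull: "affine hull (y ` K) = UNIV"
    and rigid: "\<And>k l. k \<in> K \<Longrightarrow> l \<in> K \<Longrightarrow> inner (y k - y l) (p k - p l) = 0"
  shows "\<exists>M t. transpose M = - M \<and> (\<forall>k\<in>K. p k = M *v y k + t)"
proof -
  obtain k0 where k0: "k0 \<in> K" using hull by fastforce
  define g where "g k = (y k - y k0, p k - p k0)" for k
  define B :: "(real^'d) \<times> (real^'d) \<Rightarrow> (real^'d) \<times> (real^'d) \<Rightarrow> real"
    where "B a b = inner (fst a) (snd b) + inner (snd a) (fst b)" for a b
  have sub: "subspace {a. B a b = 0}" "subspace {b. B a b = 0}" for a b
    by (auto simp: subspace_def B_def inner_add_left inner_add_right algebra_simps
         simp flip: distrib_left)
  \<comment> \<open>Polarization: expand the rigidity condition for \<open>k\<close>,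
    \<open>l\<close> around \<open>k0\<close> and remove the two diagonal terms.\<close>
  have gg: "B (g k) (g l) = 0" if "k \<in> K" "l \<in> K" for k l
    using rigid[OF that] rigid[OF that(1) k0] rigid[OF that(2) k0]
    by (simp add: B_def g_def inner_diff_left inner_diff_right inner_commute)
  have 1: "B (g k) b = 0" if "k \<in> K" "b \<in> span (g ` K)" for k b
    using that(2) by (rule span_induct) (use sub gg that(1) in blast)+
  have iso: "B a b = 0" if "a \<in> span (g ` K)" "b \<in> span (g ` K)" for a b
    using that(1) by (rule span_induct) (use sub 1 that(2) in blast)+
  \<comment> \<open>Translating the affine hull by \<open>y k0\<close> shows that the differences
    from \<open>y k0\<close> span the space, so \<open>fst\<close> maps the span of the pairs onto
    it.\<close>
  have hull': "UNIV = (+) (y k0) ` span ((+) (- y k0) ` y ` K)"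
    using affine_hull_span_gen[of "y k0" "y ` K"] k0 hull by (simp add: hull_inc)
  have "u \<in> span ((+) (- y k0) ` y ` K)" for u
  proof -
    have "y k0 + u \<in> (+) (y k0) ` span ((+) (- y k0) ` y ` K)"
      by (subst hull'[symmetric]) simp
    then show ?thesis by auto
  qed
  then have "span ((+) (- y k0) ` y ` K) = UNIV" by blast
  moreover have "(+) (- y k0) ` y ` K = fst ` g ` K"
    by (simp add: g_def image_image)
  ultimately have "fst ` span (g ` K) = UNIV"
    by (simp add: linear_span_image[symmetric] linear_fst)
  then have "\<forall>a. \<exists>b. (a, b) \<in> span (g ` K)" by (metis UNIV_I imageE prod.collapse)
  then obtain h where h: "\<And>a. (a, h a) \<in> span (g ` K)" by metis
  have skew: "inner a (h c) + inner (h a) c = 0" for a c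
    using iso[OF h h, of a c] by (simp add: B_def)
  \<comment> \<open>By isotropy, two pairs with the same first component \<open>a\<close> have
    second components with equal inner product against every \<open>c\<close>.\<close>
  have single: "b = h a" if "(a, b) \<in> span (g ` K)" for a b
  proof -
    have "inner c (h a) + inner (h c) a = 0" "inner c b + inner (h c) a = 0" for c
      using iso[OF h h, of c a] iso[OF h that, of c] by (simp_all add: B_def)
    then have "inner c (b - h a) = 0" for c
      by (metis add_right_cancel inner_diff_right right_minus_eq)
    then show ?thesis by (metis inner_eq_zero_iff right_minus_eq)
  qed
  have lin: "linear h"
  proof (rule linearI)
    show "h (a + c) = h a + h c" for a c
      using single[of "a + c" "h a + h c"] span_add[OF h h, of a c] by simp
    show "h (r *\<^sub>R a) = r *\<^sub>R h a" for r a
      using single[of "r *\<^sub>R a" "r *\<^sub>R h a"] span_scale[OF h, of r a] by simp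
  qed
  define M where "M = matrix h"
  have M: "M *v a = h a" for a unfolding M_def using lin by simp
  have "inner (axis i 1) (M *v axis j 1) + inner (M *v axis i 1) (axis j 1) = 0" for i j
    by (simp add: M skew)
  then have "M $ i $ j + M $ j $ i = 0" for i j
    by (simp add: matrix_vector_mult_basis inner_axis inner_axis' column_def)
  then have "transpose M = - M"
    by (simp add: vec_eq_iff transpose_def eq_neg_iff_add_eq_0)
  moreover have "p k = M *v y k + (p k0 - M *v y k0)" if "k \<in> K" for k
  proof -
    have "p k - p k0 = h (y k - y k0)"
      by (rule single) (use that in \<open>auto simp: g_def intro: span_base\<close>)
    then show ?thesis by (simp add: M linear_diff[OF lin] algebra_simps)
  qed
  ultimately show ?thesis by blast
qed

lemma affine_hull_rigid_image:
  fixes Q :: "real^'d^'d"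
  assumes Q: "orthogonal_matrix Q" and hull: "affine hull X = UNIV"
  shows "affine hull ((\<lambda>v. w + transpose Q *v v) ` X) = UNIV"
proof -
  have "affine hull ((\<lambda>v. w + transpose Q *v v) ` X)
      = (\<lambda>v. w + v) ` ((*v) (transpose Q)) ` (affine hull X)"
    by (simp add: affine_hull_translation affine_hull_linear_image matrix_vector_mul_bounded_linear
      flip: image_image)
  also have "\<dots> = UNIV"
  proof -
    have "u = w + transpose Q *v (Q *v (u - w))" for u
      by (simp add: orthogonal_matrix_cancel[OF Q])
    then show ?thesis unfolding hull by blast
  qed
  finally show ?thesis .
qed

lemma graph_connected_const:
  assumes "graph_connected (E :: ('n::finite \<times> 'm::finite) set)"
    and "\<And>k i. (k, i) \<in> E \<Longrightarrow> f (Inl k) = f (Inr i)"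
  shows "f u = f v"
proof -
  define A where "A = {(Inl k :: 'n + 'm, Inr i :: 'n + 'm) | k i. (k, i) \<in> E}"
  have "(u, v) \<in> (A \<union> A\<inverse>)\<^sup>*"
    using assms(1) by (simp add: graph_connected_def A_def Let_def)
  then show ?thesis
    by induction (use assms(2) in \<open>auto simp: A_def\<close>)
qed

text \<open>The centering factor subtracts the mean of the point positions from each column, so the
  realization is a translate of the optimal point positions.\<close>

lemma realization_column:
  fixes E :: "('n::finite \<times> 'm::finite) set"
  shows "\<exists>c. \<forall>k. column k (realization E x S) = column (Inl k) (opt_pos E x S) - c"
proof -
  let ?Z = "opt_pos E x S"
  define Y where "Y = (\<chi> a k. ?Z $ a $ Inl k)"
  have "transpose (stack S) ** B_mat E x ** (\<chi> v k. pinv (laplacian E) $ v $ Inl k) = Y"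
    by (simp add: Y_def opt_pos_def matrix_matrix_mult_def vec_eq_iff)
  then have "realization E x S = Y - (1 / real CARD('n)) *\<^sub>R outer (Y *v 1) 1"
    by (simp add: realization_def matrix_mul.diff_right matrix_mul.scaleR_right matrix_mul_outer)
  then have "column k (realization E x S) = column (Inl k) ?Z - (1 / real CARD('n)) *\<^sub>R (Y *v 1)" for k
    by (simp add: column_def vec_eq_iff outer_def) (simp add: Y_def)
  then show ?thesis by blast
qed

lemma transpose_skew_mul:
  fixes M :: "real^'d^'d"
  assumes "transpose M = - M"
  shows "transpose (Q ** M) *v v = - (M *v (transpose Q *v v))"
  by (simp add: matrix_transpose_mul assms matrix_vector_mul.minus_left flip: matrix_vector_mul_assoc)

section \<open>Motions and tangent vectors described by one skew matrix per view\<close>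

context
  fixes E :: "('n::finite \<times> 'm::finite) set"
    and x :: "'n \<Rightarrow> 'm \<Rightarrow> real^'d::finite"
    and v1 :: 'm
    and S :: "real^'d^'d^'m"
    and y :: "'n \<Rightarrow> real^'d" and w :: "'m \<Rightarrow> real^'d"
  assumes conn: "graph_connected E"
    and nondeg: "\<And>i. affinely_nondegenerate_view E x i"
    and S: "alignment S"
    and y: "\<And>k i. (k, i) \<in> E \<Longrightarrow> y k - w i = transpose (S $ i) *v x k i"
begin

lemma orth_S: "orthogonal_matrix (S $ i)"
  using S by (simp add: alignment_def)

text \<open>Within a view, \<open>y\<close> is the image of the local coordinates under a Euclidean
  isometry.\<close>

lemma affine_hull_view: "affine hull (y ` {k. (k, i) \<in> E}) = UNIV"
proof -
  have "affine hull {x k i | k. (k, i) \<in> E} = UNIV"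
    using nondeg[of i] by (simp add: affinely_nondegenerate_view_def flip: aff_dim_eq_full)
  moreover have "y ` {k. (k, i) \<in> E}
      = (\<lambda>v. w i + transpose (S $ i) *v v) ` {x k i | k. (k, i) \<in> E}"
    by (force simp flip: y)
  ultimately show ?thesis by (simp only: affine_hull_rigid_image[OF orth_S])
qed

text \<open>Tangent vectors at an orthogonal \<open>T\<close> are \<open>T ** W\<close> with
  \<open>W\<close> skew. For \<open>T = S $ i ** transpose (S $ v1)\<close>, conjugating
  \<open>W\<close> by \<open>S $ v1\<close> produces \<open>M i\<close>, which is again
  skew.\<close>

lemma tangent_space_quot_proj_iff:
  "V \<in> tangent_space v1 (quot_proj v1 S) \<longleftrightarrow>
    (\<exists>M. (\<forall>i. transpose (M i) = - M i) \<and> M v1 = 0 \<and>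
      (\<forall>i. V $ i = S $ i ** M i ** transpose (S $ v1)))" (is "?L \<longleftrightarrow> ?R")
proof
  assume L: ?L
  define M where "M i = transpose (S $ i) ** V $ i ** S $ v1" for i
  have V: "V $ i = S $ i ** M i ** transpose (S $ v1)" for i
  proof -
    have "S $ i ** M i ** transpose (S $ v1)
      = (S $ i ** transpose (S $ i)) ** V $ i ** (S $ v1 ** transpose (S $ v1))"
      by (simp only: M_def matrix_mul_assoc)
    then show ?thesis by (simp add: orthogonal_matrix_cancel(2)[OF orth_S])
  qed
  have V1: "V $ v1 = 0" using L by (simp add: tangent_space_def)
  have "transpose (M i) + M i = 0" for i
  proof (cases "i = v1")
    case True
    then show ?thesis by (simp add: M_def V1 linear_0[OF linear_transpose])
  next
    case False
    let ?T = "S $ i ** transpose (S $ v1)"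
    have "transpose (V $ i) ** ?T + transpose ?T ** V $ i = 0"
      using L False by (simp add: tangent_space_def quot_proj_def)
    then have "transpose (S $ v1) ** (transpose (V $ i) ** ?T + transpose ?T ** V $ i) ** S $ v1 = 0"
      by simp
    then have "transpose (M i) ** (transpose (S $ v1) ** S $ v1)
       + (transpose (S $ v1) ** S $ v1) ** M i = 0"
      by (simp add: M_def matrix_mul.add_left matrix_mul.add_right matrix_transpose_mul matrix_mul_assoc)
    then show ?thesis by (simp add: orthogonal_matrix_cancel(1)[OF orth_S])
  qed
  then have "transpose (M i) = - M i" for i by (simp add: eq_neg_iff_add_eq_0)
  moreover have "M v1 = 0" by (simp add: M_def V1)
  ultimately show ?R using V by blast
next
  assume ?R
  then obtain M where M: "\<And>i. transpose (M i) = - M i" "M v1 = 0"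
    and V: "\<And>i. V $ i = S $ i ** M i ** transpose (S $ v1)" by blast
  let ?Q = "S $ v1"
  have "transpose (V $ i) ** (S $ i ** transpose ?Q) + transpose (S $ i ** transpose ?Q) ** V $ i = 0"
    for i
  proof -
    have "transpose (V $ i) ** (S $ i ** transpose ?Q)
       = ?Q ** transpose (M i) ** (transpose (S $ i) ** S $ i) ** transpose ?Q"
      by (simp only: V matrix_transpose_mul matrix_mul_assoc transpose_transpose)
    moreover have "transpose (S $ i ** transpose ?Q) ** V $ i
       = ?Q ** (transpose (S $ i) ** S $ i) ** M i ** transpose ?Q"
      by (simp only: V matrix_transpose_mul matrix_mul_assoc transpose_transpose)
    ultimately show ?thesis
      by (simp add: orthogonal_matrix_cancel(1)[OF orth_S] M(1) matrix_mul.minus_left matrix_mul.minus_right)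
  qed
  then show ?L
    by (simp add: tangent_space_def quot_proj_def V M(2))
qed

text \<open>Skewness rewrites each edge equation in terms of \<open>y k - w i\<close>; the rotation
  \<open>S $ v1\<close> and a sign then pass between \<open>z\<close> and \<open>p\<close>, and the
  terms \<open>M i *v w i\<close> are absorbed into \<open>t\<close>.\<close>

lemma F_obj_skew_eq_0_iff:
  assumes M: "\<And>i. transpose (M i) = - M i"
    and V: "\<And>i. V $ i = S $ i ** M i ** transpose (S $ v1)"
  shows "F_obj E x V = 0 \<longleftrightarrow> (\<exists>p t. \<forall>(k, i)\<in>E. p k = M i *v y k + t i)"
proof -
  let ?Q = "S $ v1"
  have edge: "transpose (V $ i) *v x k i = - (?Q *v (M i *v (y k - w i)))" if "(k, i) \<in> E" for k i
  proof -
    have "transpose (V $ i) *v x k i = ?Q *v (transpose (S $ i ** M i) *v x k i)"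
      by (simp add: V matrix_transpose_mul matrix_vector_mul_assoc matrix_mul_assoc)
    then show ?thesis
      by (simp add: transpose_skew_mul M y that matrix_vector_mul.minus_right)
  qed
  show ?thesis
    unfolding F_obj_eq_0_iff
  proof
    assume "\<exists>z. \<forall>(k, i)\<in>E. z (Inl k) - z (Inr i) = transpose (V $ i) *v x k i"
    then obtain z where z: "\<And>k i. (k, i) \<in> E \<Longrightarrow> z (Inl k) - z (Inr i) = - (?Q *v (M i *v (y k - w i)))"
      using edge by fastforce
    have "- (transpose ?Q *v z (Inl k)) = M i *v y k + (- (transpose ?Q *v z (Inr i)) - M i *v w i)"
      if "(k, i) \<in> E" for k i
    proof -
      have "transpose ?Q *v (z (Inl k) - z (Inr i)) = - (M i *v (y k - w i))"
        by (simp only: z[OF that] matrix_vector_mul.minus_right orthogonal_matrix_cancel(3)[OF orth_S])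
      then show ?thesis by (simp add: matrix_vector_mul.diff_right algebra_simps)
    qed
    then show "\<exists>p t. \<forall>(k, i)\<in>E. p k = M i *v y k + t i"
      by (intro exI[of _ "\<lambda>k. - (transpose ?Q *v z (Inl k))"]
         exI[of _ "\<lambda>i. - (transpose ?Q *v z (Inr i)) - M i *v w i"]) blast
  next
    assume "\<exists>p t. \<forall>(k, i)\<in>E. p k = M i *v y k + t i"
    then obtain p t where p: "\<And>k i. (k, i) \<in> E \<Longrightarrow> p k = M i *v y k + t i" by blast
    define z where "z v = (case v of Inl k \<Rightarrow> - (?Q *v p k) | Inr i \<Rightarrow> - (?Q *v (M i *v w i + t i)))" for v
    have "z (Inl k) - z (Inr i) = transpose (V $ i) *v x k i" if "(k, i) \<in> E" for k i
      unfolding edge[OF that]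
      by (simp add: z_def p[OF that] matrix_vector_mul.diff_right matrix_vector_mul.add_right algebra_simps)
    then show "\<exists>z. \<forall>(k, i)\<in>E. z (Inl k) - z (Inr i) = transpose (V $ i) *v x k i" by blast
  qed
qed

text \<open>Multiplication by orthogonal matrices is invertible, so \<open>V\<close> vanishes
  exactly when \<open>M\<close> does. The right-hand side is the criterion also found for rigidity
  below.\<close>

lemma tangent_kernel_trivial_iff:
  "(\<forall>V\<in>tangent_space v1 (quot_proj v1 S). F_obj E x V = 0 \<longrightarrow> V = 0) \<longleftrightarrow>
   (\<forall>M p t. (\<forall>i. transpose (M i) = - M i) \<and> M v1 = 0 \<and> (\<forall>(k, i)\<in>E. p k = M i *v y k + t i)
      \<longrightarrow> M = (\<lambda>_. 0))" (is "?L \<longleftrightarrow> ?R")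
proof
  assume L: ?L
  show ?R
  proof (intro allI impI, elim conjE)
    fix M :: "'m \<Rightarrow> real^'d^'d" and p t
    assume M: "\<forall>i. transpose (M i) = - M i" "M v1 = 0" and p: "\<forall>(k, i)\<in>E. p k = M i *v y k + t i"
    define V where "V = (\<chi> i. S $ i ** M i ** transpose (S $ v1))"
    have "V \<in> tangent_space v1 (quot_proj v1 S)"
      unfolding tangent_space_quot_proj_iff using M by (auto simp: V_def)
    moreover have "F_obj E x V = 0"
      by (subst F_obj_skew_eq_0_iff[of M]) (use M p in \<open>auto simp: V_def\<close>)
    ultimately have "V = 0" using L by blast
    have "M i = 0" for i
    proof -
      have "M i = (transpose (S $ i) ** S $ i) ** M i ** (transpose (S $ v1) ** S $ v1)"
        by (simp add: orthogonal_matrix_cancel(1)[OF orth_S])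
      also have "\<dots> = transpose (S $ i) ** V $ i ** S $ v1"
        by (simp add: V_def matrix_mul_assoc)
      finally show ?thesis by (simp add: \<open>V = 0\<close>)
    qed
    then show "M = (\<lambda>_. 0)" by blast
  qed
next
  assume R: ?R
  show ?L
  proof (intro ballI impI)
    fix V assume V: "V \<in> tangent_space v1 (quot_proj v1 S)" "F_obj E x V = 0"
    obtain M where M: "\<And>i. transpose (M i) = - M i" "M v1 = 0"
      "\<And>i. V $ i = S $ i ** M i ** transpose (S $ v1)"
      using V(1) unfolding tangent_space_quot_proj_iff by blast
    have "M = (\<lambda>_. 0)"
      using R M(1,2) V(2) F_obj_skew_eq_0_iff[of M, OF M(1,3)] by blast
    then show "V = 0" by (simp add: vec_eq_iff[of V] M(3))
  qed
qed

lemma infinitesimally_rigid_iff: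
  "infinitesimally_rigid E y \<longleftrightarrow>
   (\<forall>M p t. (\<forall>i. transpose (M i) = - M i) \<and> M v1 = 0 \<and> (\<forall>(k, i)\<in>E. p k = M i *v y k + t i)
      \<longrightarrow> M = (\<lambda>_. 0))" (is "?L \<longleftrightarrow> ?R")
proof
  assume L: ?L
  show ?R
  proof (intro allI impI, elim conjE)
    fix M :: "'m \<Rightarrow> real^'d^'d" and p t
    assume M: "\<forall>i. transpose (M i) = - M i" "M v1 = 0" and p: "\<forall>(k, i)\<in>E. p k = M i *v y k + t i"
    have skew: "inner u (M i *v u) = 0" for i u
    proof -
      have "inner u (M i *v u) = inner (M i *v u) u" by (rule inner_commute)
      also have "\<dots> = - inner u (M i *v u)"
        by (simp only: inner_matrix_vector_left M matrix_vector_mul.minus_left inner_minus_right)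
      finally show ?thesis by simp
    qed
    have pd: "p k - p l = M i *v (y k - y l)" if "(k, i) \<in> E" "(l, i) \<in> E" for k l i
      using bspec[OF p that(1)] bspec[OF p that(2)] by (simp add: matrix_vector_mul.diff_right)
    have "trivial_motion y p"
      using L unfolding infinitesimally_rigid_def by (metis pd skew)
    then obtain N s where N: "\<And>k. p k = N *v y k + s"
      unfolding trivial_motion_def by blast
    \<comment> \<open>The points of each view affinely span the space, so the global
      \<open>N\<close> agrees with every \<open>M i\<close>; the case \<open>v1\<close> then forces
      \<open>N = 0\<close>.\<close>
    have "N = M i" for i
    proof (rule matrix_eq_if_affine_hull_UNIV[OF affine_hull_view[of i]])
      fix u v assume "u \<in> y ` {k. (k, i) \<in> E}" "v \<in> y ` {k. (k, i) \<in> E}"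
      then obtain k l where "u = y k" "v = y l" "(k, i) \<in> E" "(l, i) \<in> E" by blast
      then show "N *v (u - v) = M i *v (u - v)"
        using pd[of k i l] by (simp add: N matrix_vector_mul.diff_right)
    qed
    then show "M = (\<lambda>_. 0)" using M(2) by metis
  qed
next
  assume R: ?R
  show ?L
    unfolding infinitesimally_rigid_def
  proof (intro notI, elim exE conjE)
    fix p assume nt: "\<not> trivial_motion y p"
      and p: "\<forall>i k1 k2. (k1, i) \<in> E \<longrightarrow> (k2, i) \<in> E \<longrightarrow> inner (y k1 - y k2) (p k1 - p k2) = 0"
    have "\<exists>M t. transpose M = - M \<and> (\<forall>k\<in>{k. (k, i) \<in> E}. p k = M *v y k + t)" for i
      by (rule isometric_velocities_skew[OF affine_hull_view]) (use p in blast)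
    then obtain M t where M: "\<And>i. transpose (M i) = - M i"
      and t: "\<And>k i. (k, i) \<in> E \<Longrightarrow> p k = M i *v y k + t i"
      by (metis (mono_tags, lifting) mem_Collect_eq)
    \<comment> \<open>Subtracting the global skew motion \<open>M v1\<close> achieves the
      normalization at \<open>v1\<close>.\<close>
    define M' p' where "M' i = M i - M v1" and "p' k = p k - M v1 *v y k" for i k
    have "(\<forall>i. transpose (M' i) = - M' i) \<and> M' v1 = 0 \<and> (\<forall>(k, i)\<in>E. p' k = M' i *v y k + t i)"
      by (auto simp: M'_def p'_def linear_diff[OF linear_transpose] M t matrix_vector_mul.diff_left)
    then have "M' = (\<lambda>_. 0)" using R by blast
    then have Meq: "M i = M v1" for i by (metis M'_def right_minus_eq)
    have p't: "p' k = t i" if "(k, i) \<in> E" for k i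
      using t[OF that] Meq[of i] by (simp add: p'_def)
    \<comment> \<open>With \<open>M'\<close> zero, \<open>p'\<close> and \<open>t\<close> agree
      along incidences, so together they form a function that connectedness makes constant.\<close>
    define f where "f v = (case v of Inl k \<Rightarrow> p' k | Inr i \<Rightarrow> t i)" for v
    have f: "f u = f v" for u v
      by (rule graph_connected_const[OF conn]) (simp add: f_def p't)
    have "p k = M v1 *v y k + t v1" for k
      using f[of "Inl k" "Inr v1"] by (simp add: f_def p'_def algebra_simps)
    then show False using nt M unfolding trivial_motion_def by blast
  qed
qed

end

theorem theorem4p1:
  fixes E :: "('n::finite \<times> 'm::finite) set"
    and x :: "'n \<Rightarrow> 'm \<Rightarrow> real^'d::finite"
    and v1 :: 'm
    and S :: "real^'d^'d^'m"
  assumes "graph_connected E"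
    and "\<And>i. affinely_nondegenerate_view E x i"
    and "alignment S"
    and "perfect E x S"
  shows "infinitesimally_rigid E (\<lambda>k. column k (realization E x S))
           \<longleftrightarrow> nondegenerate_alignment v1 E x S"
proof -
  have F0: "F_obj E x S = 0" using assms(4) by (simp add: perfect_def)
  have orth: "orthogonal_matrix (S $ i)" for i using assms(3) by (simp add: alignment_def)
  define z where "z v = column v (opt_pos E x S)" for v
  have z: "z (Inl k) - z (Inr i) = transpose (S $ i) *v x k i" if "(k, i) \<in> E" for k i
    using opt_pos_edge[OF F0 that] by (simp add: z_def matrix_mul_edge_vec)
  obtain c where c: "\<And>k. column k (realization E x S) = z (Inl k) - c"
    using realization_column[of E x S] unfolding z_def by blast
  \<comment> \<open>Points and views are shifted by the same \<open>c\<close>, which preserves the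
    edge differences.\<close>
  define w where "w i = z (Inr i) - c" for i
  have y: "column k (realization E x S) - w i = transpose (S $ i) *v x k i" if "(k, i) \<in> E" for k i
    using z[OF that] by (simp add: c w_def)
  have "quot_proj v1 S \<in> OM v1"
    by (simp add: OM_def quot_proj_def orthogonal_matrix_mul orth)
  moreover have "F_tilde v1 E x (quot_proj v1 S) = 0"
  proof -
    have P: "prepend_id v1 (quot_proj v1 S) $ i = S $ i ** transpose (S $ v1)" for i
      by (simp add: prepend_id_def quot_proj_def orthogonal_matrix_cancel(2)[OF orth])
    \<comment> \<open>Multiplying all blocks of \<open>S\<close> on the right by
      \<open>transpose (S $ v1)\<close> is matched by rotating the vertex positions by
      \<open>S $ v1\<close>.\<close>
    have "S $ v1 *v z (Inl k) - S $ v1 *v z (Inr i)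
        = transpose (S $ i ** transpose (S $ v1)) *v x k i" if "(k, i) \<in> E" for k i
      using arg_cong[OF z[OF that], of "(*v) (S $ v1)"]
      by (simp add: matrix_transpose_mul matrix_vector_mul.diff_right matrix_vector_mul_assoc)
    then show ?thesis
      unfolding F_tilde_eq F_obj_eq_0_iff P by (intro exI[of _ "\<lambda>v. S $ v1 *v z v"]) blast
  qed
  ultimately have "nondegenerate_alignment v1 E x S \<longleftrightarrow>
      (\<forall>V\<in>tangent_space v1 (quot_proj v1 S). F_obj E x V = 0 \<longrightarrow> V = 0)"
    by (simp only: nondegenerate_alignment_def nondegenerate_local_min_F_tilde_iff)
  also have "\<dots> \<longleftrightarrow> infinitesimally_rigid E (\<lambda>k. column k (realization E x S))"
    using infinitesimally_rigid_iff[OF assms(1-3) y] tangent_kernel_trivial_iff[OF assms(1-3) y]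
    by blast
  finally show ?thesis ..
qed

end
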